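(* Let $(\varphi_n)_{n\ge1}$ be an orthonormal system on $[0,1]$ and let $(d_n)_{n\ge1}$ be any bounded sequence of positive numbers. For $\varepsilon=(\varepsilon_n)\in\Delta$ and $N\ge 1$ put $$Q_N(x,\varepsilon)=\sum_{k=1}^{N} d_k\,k^{1/2}\varphi_k(x)\,\varepsilon_k,\qquad D_N(\varepsilon)=\frac1N\sum_{i=1}^{N-1}\left|\int_0^{i/N}Q_N(x,\varepsilon)\,dx\right| .$$ If for some $\varepsilon^0=(\varepsilon^0_n)\in\Delta$ $$\limsup_{N\to\infty} D_N(\varepsilon^0)=+\infty,$$ then $(d_n)$ is not an absolute convergence factor for the class $Lip1$, i.e. there exists $f_0\in Lip1$ with $$\sum_{k=1}^\infty |c_k(f_0)|\,k^{1/2}d_k=+\infty .$$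
   Context: All functions are real-valued. An orthonormal system $(\varphi_n)_{n\ge1}$ on $[0,1]$ (ONS) is a sequence in $L_2(0,1)$ with $\int_0^1\varphi_n\varphi_m\,dx=\delta_{nm}$; it is not assumed complete. For $f\in L_2(0,1)$, the Fourier coefficients are $c_n(f)=\int_0^1 f(x)\varphi_n(x)\,dx$. $Lip1$ is the class of functions $f:[0,1]\to\mathbb{R}$ for which there is a constant $M$ (depending on $f$) with $|f(x)-f(y)|\le M|x-y|$ for all $x,y\in[0,1]$. $\Delta$ is the set of all sequences $\varepsilon=(\varepsilon_n)_{n\ge1}$ with $\varepsilon_n\in\{-1,0,1\}$ for every $n$. A bounded sequence of positive numbers $(d_k)$ is an absolute convergence factor (with respect to $(\varphi_n)$) for a function class $E$ if $\sum_{k=1}^\infty|c_k(f)|k^{1/2}d_k<+\infty$ for all $f\in E$. *)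

theory Defs
  imports "HOL-Analysis.Analysis"
begin

text \<open>
  Functions on \<open>[0,1]\<close> are functions on \<open>real\<close> whose values outside
  \<open>{0..1}\<close> are irrelevant; sequences indexed from \<open>1\<close> are functions on
  \<open>nat\<close> whose value at \<open>0\<close> is irrelevant.
\<close>

definition L2_01 :: "(real \<Rightarrow> real) set" where
  "L2_01 = {f. set_borel_measurable lebesgue {0..1} f \<and>
               set_integrable lebesgue {0..1} (\<lambda>x. (f x)\<^sup>2)}"

definition orthonormal_system :: "(nat \<Rightarrow> real \<Rightarrow> real) \<Rightarrow> bool" where
  "orthonormal_system \<phi> \<longleftrightarrow>
     (\<forall>n\<ge>1. \<phi> n \<in> L2_01) \<and>
     (\<forall>n\<ge>1. \<forall>m\<ge>1. (LINT x:{0..1}|lebesgue. \<phi> n x * \<phi> m x) = (if n = m then 1 else 0))"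

definition fourier_coeff :: "(nat \<Rightarrow> real \<Rightarrow> real) \<Rightarrow> (real \<Rightarrow> real) \<Rightarrow> nat \<Rightarrow> real" where
  "fourier_coeff \<phi> f n = (LINT x:{0..1}|lebesgue. f x * \<phi> n x)"

definition Lip1 :: "(real \<Rightarrow> real) set" where
  "Lip1 = {f. \<exists>M. M-lipschitz_on {0..1} f}"

definition Delta :: "(nat \<Rightarrow> real) set" where
  "Delta = {\<epsilon>. \<forall>n\<ge>1. \<epsilon> n \<in> {-1, 0, 1}}"

text \<open>
  The series \<open>\<Sum>k\<ge>1. \<bar>c\<^sub>k(f)\<bar> k\<^sup>1\<^sup>/\<^sup>2 d\<^sub>k\<close> as an extended nonnegative number; it is
  meant for positive \<open>d\<close> only (\<open>ennreal\<close> sends negative terms to \<open>0\<close>).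
\<close>

definition weighted_coeff_series ::
    "(nat \<Rightarrow> real \<Rightarrow> real) \<Rightarrow> (nat \<Rightarrow> real) \<Rightarrow> (real \<Rightarrow> real) \<Rightarrow> ennreal" where
  "weighted_coeff_series \<phi> d f =
     (\<Sum>k. ennreal (\<bar>fourier_coeff \<phi> f (Suc k)\<bar> * sqrt (real (Suc k)) * d (Suc k)))"

definition bounded_positive_seq :: "(nat \<Rightarrow> real) \<Rightarrow> bool" where
  "bounded_positive_seq d \<longleftrightarrow> bounded (d ` {1..}) \<and> (\<forall>k\<ge>1. d k > 0)"

definition absolute_convergence_factor ::
    "(nat \<Rightarrow> real \<Rightarrow> real) \<Rightarrow> (nat \<Rightarrow> real) \<Rightarrow> (real \<Rightarrow> real) set \<Rightarrow> bool" where
  "absolute_convergence_factor \<phi> d E \<longleftrightarrow>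
     bounded_positive_seq d \<and> (\<forall>f\<in>E. weighted_coeff_series \<phi> d f < \<infinity>)"

definition Q ::
    "(nat \<Rightarrow> real \<Rightarrow> real) \<Rightarrow> (nat \<Rightarrow> real) \<Rightarrow> nat \<Rightarrow> real \<Rightarrow> (nat \<Rightarrow> real) \<Rightarrow> real" where
  "Q \<phi> d N x \<epsilon> = (\<Sum>k=1..N. d k * sqrt (real k) * \<phi> k x * \<epsilon> k)"

definition D ::
    "(nat \<Rightarrow> real \<Rightarrow> real) \<Rightarrow> (nat \<Rightarrow> real) \<Rightarrow> nat \<Rightarrow> (nat \<Rightarrow> real) \<Rightarrow> real" where
  "D \<phi> d N \<epsilon> =
     1 / real N * (\<Sum>i=1..N-1. \<bar>LINT x:{0..real i / real N}|lebesgue. Q \<phi> d N x \<epsilon>\<bar>)"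

end

theory Submission
  imports Defs
begin

text \<open>
  If every Lipschitz \<open>f\<close> had a finite series, then by uniform boundedness the partial sums
  \<open>\<Sum>k\<le>N. \<bar>c\<^sub>k(f)\<bar> k\<^sup>1\<^sup>/\<^sup>2 d\<^sub>k\<close> would be bounded uniformly in \<open>N\<close> and in \<open>f\<close> from the unit ball.
  Now \<open>D\<^sub>N = \<integral> h Q\<^sub>N\<close> for the step function \<open>h = 1/N \<Sum>i s\<^sub>i 1\<^bsub>[0, i/N]\<^esub>\<close>, where \<open>s\<^sub>i\<close> is the sign
  of \<open>\<integral> Q\<^sub>N\<close> over \<open>[0, i/N]\<close>. Replacing each jump of \<open>h\<close> by a ramp of slope at most \<open>1\<close> on
  \<open>[i/N, (i+1)/N]\<close> gives an \<open>f\<close> in the unit ball with \<open>\<bar>f - h\<bar> \<le> 1/N\<close>, and the error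
  \<open>1/N \<integral> \<bar>Q\<^sub>N\<bar>\<close> is bounded because \<open>\<integral> Q\<^sub>N\<^sup>2 = O(N\<^sup>2)\<close> by orthonormality.
\<close>

subsection \<open>Uniform boundedness on Lipschitz functions\<close>

text \<open>The ball of radius \<open>r\<close> for the larger of the sup norm and the Lipschitz
  constant. Functions are controlled on the whole line, which keeps sums and scalings free of side
  conditions; membership implies membership in \<open>Lip1\<close>.\<close>

definition lip_ball :: "real \<Rightarrow> (real \<Rightarrow> real) set" where
  "lip_ball r = {f. r-lipschitz_on UNIV f \<and> (\<forall>x. \<bar>f x\<bar> \<le> r)}"

lemma lip_ballI:
  assumes "0 \<le> r" "\<And>x y. x \<le> y \<Longrightarrow> \<bar>f x - f y\<bar> \<le> r * (y - x)" "\<And>x. \<bar>f x\<bar> \<le> r"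
  shows "f \<in> lip_ball r"
proof -
  have "\<bar>f x - f y\<bar> \<le> r * \<bar>x - y\<bar>" for x y
    using assms(2)[of x y] assms(2)[of y x] by (cases "x \<le> y") (auto simp: abs_minus_commute)
  then show ?thesis
    using assms unfolding lip_ball_def by (auto intro!: lipschitz_onI simp: dist_real_def)
qed

lemma lip_ballD:
  assumes "f \<in> lip_ball r"
  shows "\<bar>f x - f y\<bar> \<le> r * \<bar>x - y\<bar>" "\<bar>f x\<bar> \<le> r" "0 \<le> r"
  using assms unfolding lip_ball_def
  by (auto dest: lipschitz_onD lipschitz_on_nonneg simp: dist_real_def)

lemma lip_ball_scale:
  assumes "f \<in> lip_ball r"
  shows "(\<lambda>x. c * f x) \<in> lip_ball (\<bar>c\<bar> * r)"
proof (rule lip_ballI)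
  show "0 \<le> \<bar>c\<bar> * r" using lip_ballD(3)[OF assms] by simp
next
  fix x y :: real assume "x \<le> y"
  then have "\<bar>c\<bar> * \<bar>f x - f y\<bar> \<le> \<bar>c\<bar> * (r * (y - x))"
    using lip_ballD(1)[OF assms, of x y] by (intro mult_left_mono) auto
  then show "\<bar>c * f x - c * f y\<bar> \<le> \<bar>c\<bar> * r * (y - x)"
    by (simp add: abs_mult[symmetric] right_diff_distrib mult.assoc)
next
  fix x show "\<bar>c * f x\<bar> \<le> \<bar>c\<bar> * r"
    using lip_ballD(2)[OF assms, of x] by (simp add: abs_mult mult_left_mono)
qed

text \<open>Stands in for completeness: if the radii are summable, the series converges pointwise
  and its sum inherits both bounds from the triangle inequality.\<close>

lemma lip_ball_suminf:
  assumes f: "\<And>i. f i \<in> lip_ball (a i)" and a: "a sums r"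
  shows "(\<lambda>x. \<Sum>i. f i x) \<in> lip_ball r" and "summable (\<lambda>i. f i x)"
proof -
  have sa: "summable a" and r: "r = suminf a" using a by (auto simp: sums_iff)
  have s: "summable (\<lambda>i. f i x)" for x
    by (rule summable_comparison_test'[OF sa]) (use lip_ballD(2)[OF f] in auto)
  show "summable (\<lambda>i. f i x)" by (rule s)
  \<comment> \<open>Used with \<open>t = y - x\<close> for the Lipschitz bound and with
    \<open>t = 1\<close> for the sup bound.\<close>
  have bound: "\<bar>suminf g\<bar> \<le> r * t" if "\<And>i. \<bar>g i\<bar> \<le> a i * t" for g t
  proof -
    have st: "summable (\<lambda>i. a i * t)" using sa by (rule summable_mult2)
    have sg: "summable (\<lambda>i. \<bar>g i\<bar>)"
      by (rule summable_comparison_test'[OF st]) (use that in auto)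
    have "\<bar>suminf g\<bar> \<le> (\<Sum>i. \<bar>g i\<bar>)" by (rule summable_rabs[OF sg])
    also have "\<dots> \<le> (\<Sum>i. a i * t)" by (rule suminf_le[OF that sg st])
    also have "\<dots> = r * t" using sa r by (simp add: suminf_mult2)
    finally show ?thesis .
  qed
  show "(\<lambda>x. \<Sum>i. f i x) \<in> lip_ball r"
  proof (rule lip_ballI)
    show "0 \<le> r" unfolding r using lip_ballD(3)[OF f] sa by (intro suminf_nonneg)
  next
    fix x y :: real assume "x \<le> y"
    then show "\<bar>(\<Sum>i. f i x) - (\<Sum>i. f i y)\<bar> \<le> r * (y - x)"
      using lip_ballD(1)[OF f, of _ x y] by (subst suminf_diff[OF s s]) (intro bound, auto)
  next
    fix x show "\<bar>\<Sum>i. f i x\<bar> \<le> r" using bound[of "\<lambda>i. f i x" 1] lip_ballD(2)[OF f] by simp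
  qed
qed

lemma lip_ball_add:
  assumes f: "f \<in> lip_ball r" and g: "g \<in> lip_ball s"
  shows "(\<lambda>x. f x + g x) \<in> lip_ball (r + s)"
proof (rule lip_ballI)
  show "0 \<le> r + s" using lip_ballD(3)[OF f] lip_ballD(3)[OF g] by simp
next
  fix x y :: real assume "x \<le> y"
  then show "\<bar>f x + g x - (f y + g y)\<bar> \<le> (r + s) * (y - x)"
    using lip_ballD(1)[OF f, of x y] lip_ballD(1)[OF g, of x y] by (simp add: distrib_right)
next
  fix x show "\<bar>f x + g x\<bar> \<le> r + s"
    using lip_ballD(2)[OF f, of x] lip_ballD(2)[OF g, of x] by linarith
qed

text \<open>
  Sokal's proof of the uniform boundedness theorem: for a seminorm \<open>p\<close>,
  \<open>max (p (F + g)) (p (F - g)) \<ge> p g\<close>, so signs can be chosen such that every partial sum of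
  \<open>\<Sum>j. \<plusminus> 3\<^bsup>-j\<^esup> g\<^sub>j\<close> has a large seminorm; the tail is too short to destroy this.
\<close>

lemma uniform_boundedness_lip_ball:
  fixes p :: "nat \<Rightarrow> (real \<Rightarrow> real) \<Rightarrow> real"
  assumes subadd: "\<And>n f g r s. f \<in> lip_ball r \<Longrightarrow> g \<in> lip_ball s \<Longrightarrow>
                     p n (\<lambda>x. f x + g x) \<le> p n f + p n g"
    and homog: "\<And>n f r c. f \<in> lip_ball r \<Longrightarrow> p n (\<lambda>x. c * f x) = \<bar>c\<bar> * p n f"
    and bdd: "\<And>n. \<exists>K. \<forall>f\<in>lip_ball 1. p n f \<le> K"
    and unbdd: "\<And>A. \<exists>n. \<exists>f\<in>lip_ball 1. p n f > A"
  shows "\<exists>r. \<exists>f\<in>lip_ball r. \<forall>A. \<exists>n. p n f > A"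
proof -
  define S where "S n = (SUP f\<in>lip_ball 1. p n f)" for n
  have bdd': "bdd_above (p n ` lip_ball 1)" for n
    using bdd[of n] by (auto simp: bdd_above_def)
  have S_upper: "p n f \<le> S n" if "f \<in> lip_ball 1" for n f
    unfolding S_def using bdd' that by (intro cSUP_upper)
  have S_scaled: "p n f \<le> r * S n" if "f \<in> lip_ball r" "r > 0" for n f r
  proof -
    have "(\<lambda>x. (1/r) * f x) \<in> lip_ball 1" using lip_ball_scale[OF that(1), of "1/r"] that by simp
    then have "p n (\<lambda>x. (1/r) * f x) \<le> S n" by (rule S_upper)
    then show ?thesis unfolding homog[OF that(1)] using that(2) by (simp add: field_simps)
  qed
  have zero: "(\<lambda>x. 0) \<in> lip_ball 1" by (rule lip_ballI) auto
  \<comment> \<open>\<open>4 ^ j\<close> outgrows the later damping by \<open>3 ^ j\<close>. The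
    fraction \<open>2/3\<close> of the supremum is attained because \<open>S n > 0\<close>, and it
    exceeds the \<open>1/2\<close> that the tail will cost.\<close>
  have "\<exists>n f. f \<in> lip_ball 1 \<and> 4 ^ j \<le> S n \<and> 2/3 * S n \<le> p n f" for j :: nat
  proof -
    obtain n f where "f \<in> lip_ball 1" "p n f > 4 ^ j" using unbdd[of "4 ^ j"] by blast
    then have S: "S n > 4 ^ j" using S_upper[of f n] by linarith
    then have "S n > 0" by (smt (verit) zero_less_power)
    then have "2/3 * S n < (SUP f\<in>lip_ball 1. p n f)" unfolding S_def[symmetric] by simp
    then obtain g where "g \<in> lip_ball 1" "2/3 * S n < p n g"
      using less_cSUP_iff[OF _ bdd'] zero by blast
    then show ?thesis using S by (intro exI[of _ n] exI[of _ g]) auto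
  qed
  then obtain \<nu> g where g: "\<And>j. g j \<in> lip_ball 1" and large: "\<And>j. 4 ^ j \<le> S (\<nu> j)"
    and near: "\<And>j. 2/3 * S (\<nu> j) \<le> p (\<nu> j) (g j)"
    by metis
  have summand: "(\<lambda>x. c / 3 ^ j * g j x) \<in> lip_ball (1 / 3 ^ j)" if "\<bar>c\<bar> = 1" for c j
    using lip_ball_scale[OF g, of "c / 3 ^ j" j] that by (simp add: abs_divide)
  have sign: "\<exists>c. \<bar>c\<bar> = 1 \<and> p (\<nu> j) (g j) / 3 ^ j \<le> p (\<nu> j) (\<lambda>x. F x + c / 3 ^ j * g j x)"
    if F: "F \<in> lip_ball r" for F r j
  proof -
    let ?F = "\<lambda>c x. F x + c / 3 ^ j * g j x"
    have plus: "?F 1 \<in> lip_ball (r + 1 / 3 ^ j)" and minus: "?F (-1) \<in> lip_ball (r + 1 / 3 ^ j)"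
      using lip_ball_add[OF F summand[of 1 j]] lip_ball_add[OF F summand[of "-1" j]] by simp_all
    \<comment> \<open>\<open>F\<close> cancels in the difference of the two candidates, so their
      seminorms add up to at least twice that of the new summand.\<close>
    have "(\<lambda>x. ?F 1 x + (-1) * ?F (-1) x) = (\<lambda>x. (2 / 3 ^ j) * g j x)"
      by (auto simp: field_simps)
    then have "2 / 3 ^ j * p (\<nu> j) (g j) = p (\<nu> j) (\<lambda>x. ?F 1 x + (-1) * ?F (-1) x)"
      using homog[OF g[of j], of "\<nu> j" "2 / 3 ^ j"] by (simp add: abs_divide)
    also have "\<dots> \<le> p (\<nu> j) (?F 1) + p (\<nu> j) (\<lambda>x. (-1) * ?F (-1) x)"
      by (rule subadd[OF plus lip_ball_scale[OF minus]])
    also have "p (\<nu> j) (\<lambda>x. (-1) * ?F (-1) x) = p (\<nu> j) (?F (-1))"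
      using homog[OF minus, of "\<nu> j" "-1"] by simp
    finally have "2 * (p (\<nu> j) (g j) / 3 ^ j) \<le> p (\<nu> j) (?F 1) + p (\<nu> j) (?F (-1))" by simp
    then consider "p (\<nu> j) (g j) / 3 ^ j \<le> p (\<nu> j) (?F 1)"
      | "p (\<nu> j) (g j) / 3 ^ j \<le> p (\<nu> j) (?F (-1))"
      by linarith
    then show ?thesis
    proof cases
      case 1 then show ?thesis by (intro exI[of _ 1]) simp
    next
      case 2 then show ?thesis by (intro exI[of _ "-1"]) simp
    qed
  qed
  define c where "c F j = (SOME c. \<bar>c\<bar> = (1::real) \<and>
      p (\<nu> j) (g j) / 3 ^ j \<le> p (\<nu> j) (\<lambda>x. F x + c / 3 ^ j * g j x))" for F j
  have c: "\<bar>c F j\<bar> = 1" "p (\<nu> j) (g j) / 3 ^ j \<le> p (\<nu> j) (\<lambda>x. F x + c F j / 3 ^ j * g j x)"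
    if "F \<in> lip_ball r" for F r j
    using someI_ex[OF sign[OF that, of j]] unfolding c_def by auto
  \<comment> \<open>The sign at stage \<open>j\<close> depends on the partial sum built so far,
    hence a recursion on functions. The properties of \<open>c\<close> hold once that sum lies in
    some ball, which \<open>F_ball\<close> supplies.\<close>
  define F where "F = rec_nat (\<lambda>x. 0::real) (\<lambda>j F x. F x + c F j / 3 ^ j * g j x)"
  have F_0: "F 0 = (\<lambda>x. 0)"
    and F_Suc: "F (Suc j) = (\<lambda>x. F j x + c (F j) j / 3 ^ j * g j x)" for j
    by (simp_all add: F_def)
  have F_ball: "\<exists>r. F j \<in> lip_ball r" for j
  proof (induction j)
    case 0 then show ?case unfolding F_0 using zero by blast
  next
    case (Suc j)
    then show ?case unfolding F_Suc using lip_ball_add[OF _ summand] c(1) by blast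
  qed
  define t where "t j x = c (F j) j / 3 ^ j * g j x" for j x
  have t_ball: "t j \<in> lip_ball (1 / 3 ^ j)" for j
    unfolding t_def using summand c(1) F_ball by blast
  have F_sum: "F j x = (\<Sum>i<j. t i x)" for j x
    by (induction j) (simp_all add: F_0 F_Suc t_def)
  have F_large: "p (\<nu> j) (g j) / 3 ^ j \<le> p (\<nu> j) (F (Suc j))" for j
    unfolding F_Suc using c(2) F_ball by blast
  \<comment> \<open>With \<open>k = 0\<close> this gives the radius \<open>3/2\<close> for
    \<open>f\<close>; with \<open>k = Suc j\<close> the radius \<open>1/2 / 3 ^ j\<close> for the
    tail after stage \<open>j\<close>.\<close>
  have geo: "(\<lambda>i. 1 / 3 ^ (i + k)) sums (3/2 / 3 ^ k :: real)" for k
    using sums_mult[OF geometric_sums[of "1/3::real"], of "1 / 3 ^ k"]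
    by (simp add: power_add power_one_over field_simps)
  define f where "f x = (\<Sum>i. t i x)" for x
  have f_ball: "f \<in> lip_ball (3/2)" and t_summable: "summable (\<lambda>i. t i x)" for x
    using lip_ball_suminf[OF t_ball, where r = "3/2"] geo[of 0] by (simp_all add: f_def[abs_def])
  \<comment> \<open>The partial sum contributes at least \<open>2/3 * S (\<nu> j)\<close> and the
    tail takes away at most \<open>1/2 * S (\<nu> j)\<close>, both divided by \<open>3 ^ j\<close>;
    the factor \<open>1/6\<close> is the difference.\<close>
  have f_large: "(4/3) ^ j / 6 \<le> p (\<nu> j) f" for j
  proof -
    define R where "R x = (\<Sum>i. t (i + Suc j) x)" for x
    have R_ball: "R \<in> lip_ball (1/2 / 3 ^ j)"
      unfolding R_def[abs_def]
      by (rule lip_ball_suminf(1)[OF t_ball]) (use geo[of "Suc j"] in simp)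
    have "F (Suc j) = (\<lambda>x. f x + (-1) * R x)"
      using suminf_minus_initial_segment[OF t_summable, of "Suc j"]
      by (auto simp: F_sum f_def R_def fun_eq_iff)
    then have "p (\<nu> j) (F (Suc j)) \<le> p (\<nu> j) f + p (\<nu> j) (\<lambda>x. (-1) * R x)"
      by (simp only:) (rule subadd[OF f_ball lip_ball_scale[OF R_ball]])
    also have "p (\<nu> j) (\<lambda>x. (-1) * R x) = p (\<nu> j) R"
      using homog[OF R_ball, of "\<nu> j" "-1"] by simp
    also have "\<dots> \<le> 1/2 / 3 ^ j * S (\<nu> j)" by (rule S_scaled[OF R_ball]) simp
    finally have "p (\<nu> j) (g j) / 3 ^ j \<le> p (\<nu> j) f + 1/2 / 3 ^ j * S (\<nu> j)"
      using F_large[of j] by linarith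
    moreover have "2/3 * S (\<nu> j) / 3 ^ j \<le> p (\<nu> j) (g j) / 3 ^ j"
      by (rule divide_right_mono[OF near]) simp
    moreover have "2/3 * S (\<nu> j) / 3 ^ j = S (\<nu> j) / 3 ^ j / 6 + 1/2 / 3 ^ j * S (\<nu> j)"
      by (simp add: field_simps)
    moreover have "4 ^ j / 3 ^ j \<le> S (\<nu> j) / 3 ^ j"
      by (rule divide_right_mono[OF large]) simp
    ultimately show ?thesis by (simp add: power_divide)
  qed
  have "\<exists>n. p n f > A" for A
  proof -
    obtain j where "6 * A < (4/3) ^ j" using real_arch_pow[of "4/3" "6 * A"] by auto
    then show ?thesis using f_large[of j] by (intro exI[of _ "\<nu> j"]) linarith
  qed
  then show ?thesis using f_ball by blast
qed

subsection \<open>Orthonormal sums\<close>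

text \<open>Restricting the measure once turns set integrals over \<open>{0..1}\<close> into plain
  integrals.\<close>

abbreviation unit_measure :: "real measure" where
  "unit_measure \<equiv> lebesgue_on {0..1}"

lemma set_integral_unit: "(LINT x:{0..1}|lebesgue. f x) = integral\<^sup>L unit_measure f"
  for f :: "real \<Rightarrow> real"
  by (simp add: set_lebesgue_integral_def integral_restrict_space)

lemma L2_01_iff:
  "f \<in> L2_01 \<longleftrightarrow> f \<in> borel_measurable unit_measure \<and> integrable unit_measure (\<lambda>x. (f x)\<^sup>2)"
  unfolding L2_01_def set_borel_measurable_def set_integrable_def
  by (simp add: integrable_restrict_space borel_measurable_restrict_space_iff)

lemma integrable_unit_const [simp]: "integrable unit_measure (\<lambda>x. c::real)"
  and integral_unit_const [simp]: "integral\<^sup>L unit_measure (\<lambda>x. c::real) = c"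
proof -
  interpret finite_measure unit_measure
    by (rule finite_measure_lebesgue_on) simp
  show "integrable unit_measure (\<lambda>x. c)" by simp
  show "integral\<^sup>L unit_measure (\<lambda>x. c) = c"
    by (simp add: measure_restrict_space)
qed

text \<open>The product is dominated pointwise by the sum of the squares.\<close>

lemma integrable_mult_L2_01:
  assumes "f \<in> L2_01" "g \<in> L2_01"
  shows "integrable unit_measure (\<lambda>x. f x * g x)"
proof (rule Bochner_Integration.integrable_bound)
  show "integrable unit_measure (\<lambda>x. (f x)\<^sup>2 + (g x)\<^sup>2)"
    using assms by (simp add: L2_01_iff)
  show "(\<lambda>x. f x * g x) \<in> borel_measurable unit_measure"
    using assms by (auto simp: L2_01_iff)
  have "\<bar>a * b\<bar> \<le> a\<^sup>2 + b\<^sup>2" for a b :: real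
    using sum_squares_bound[of "\<bar>a\<bar>" "\<bar>b\<bar>"] mult_nonneg_nonneg[OF abs_ge_zero abs_ge_zero, of a b]
    unfolding abs_mult power2_abs by linarith
  then show "AE x in unit_measure. norm (f x * g x) \<le> norm ((f x)\<^sup>2 + (g x)\<^sup>2)"
    by simp
qed

lemma const_L2_01: "(\<lambda>x. c) \<in> L2_01"
  by (simp add: L2_01_iff)

lemma integrable_L2_01: "f \<in> L2_01 \<Longrightarrow> integrable unit_measure f"
  using integrable_mult_L2_01[OF const_L2_01[of 1]] by simp

text \<open>Here \<open>f\<close> is continuous, hence measurable, and bounded by \<open>r\<close>,
  so \<open>r * g\<close> dominates the product.\<close>

lemma integrable_lip_ball_mult:
  assumes "f \<in> lip_ball r" "g \<in> L2_01"
  shows "integrable unit_measure (\<lambda>x. f x * g x)"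
proof (rule Bochner_Integration.integrable_bound)
  show "integrable unit_measure (\<lambda>x. r * g x)" using integrable_L2_01[OF assms(2)] by simp
  have "continuous_on UNIV f"
    using assms(1) by (auto simp: lip_ball_def intro: lipschitz_on_continuous_on)
  then have "f \<in> borel_measurable unit_measure"
    by (rule continuous_imp_measurable_on_sets_lebesgue[OF continuous_on_subset[OF _ subset_UNIV]]) simp
  then show "(\<lambda>x. f x * g x) \<in> borel_measurable unit_measure"
    using assms(2) by (auto simp: L2_01_iff)
  show "AE x in unit_measure. norm (f x * g x) \<le> norm (r * g x)"
    using lip_ballD(2,3)[OF assms(1)] by (auto simp: abs_mult intro!: mult_right_mono)
qed

lemma L2_01_sum:
  assumes "finite A" "\<And>k. k \<in> A \<Longrightarrow> f k \<in> L2_01"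
  shows "(\<lambda>x. \<Sum>k\<in>A. a k * f k x) \<in> L2_01"
proof -
  have "(\<lambda>x. \<Sum>j\<in>A. \<Sum>k\<in>A. (a j * a k) * (f j x * f k x)) = (\<lambda>x. (\<Sum>k\<in>A. a k * f k x)\<^sup>2)"
    by (simp add: power2_eq_square sum_product mult_ac)
  moreover have "integrable unit_measure (\<lambda>x. \<Sum>j\<in>A. \<Sum>k\<in>A. (a j * a k) * (f j x * f k x))"
    using assms integrable_mult_L2_01
    by (intro Bochner_Integration.integrable_sum Bochner_Integration.integrable_mult_right) auto
  ultimately show ?thesis
    using assms by (auto simp: L2_01_iff intro!: borel_measurable_sum borel_measurable_times)
qed

text \<open>Pythagoras: expand the square into a double sum, of which only the diagonal
  survives.\<close>

lemma orthonormal_integral_square_sum: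
  assumes "orthonormal_system \<phi>"
  shows "(\<integral>x. (\<Sum>k=1..N. a k * \<phi> k x)\<^sup>2 \<partial>unit_measure) = (\<Sum>k=1..N. (a k)\<^sup>2)"
proof -
  have L2: "\<phi> k \<in> L2_01" if "k \<ge> 1" for k
    using assms that by (simp add: orthonormal_system_def)
  have ortho: "(\<integral>x. \<phi> j x * \<phi> k x \<partial>unit_measure) = (if j = k then 1 else 0)"
    if "j \<ge> 1" "k \<ge> 1" for j k
    using assms that by (simp add: orthonormal_system_def set_integral_unit)
  have int: "integrable unit_measure (\<lambda>x. (a j * a k) * (\<phi> j x * \<phi> k x))"
    if "j \<ge> 1" "k \<ge> 1" for j k
    using integrable_mult_L2_01[OF L2 L2] that by simp
  have "(\<integral>x. (\<Sum>k=1..N. a k * \<phi> k x)\<^sup>2 \<partial>unit_measure) =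
      (\<integral>x. (\<Sum>j=1..N. \<Sum>k=1..N. (a j * a k) * (\<phi> j x * \<phi> k x)) \<partial>unit_measure)"
    by (simp add: power2_eq_square sum_product mult_ac)
  also have "\<dots> = (\<Sum>j=1..N. \<Sum>k=1..N. \<integral>x. (a j * a k) * (\<phi> j x * \<phi> k x) \<partial>unit_measure)"
    using int by (subst Bochner_Integration.integral_sum)
      (auto intro!: sum.cong Bochner_Integration.integral_sum)
  also have "\<dots> = (\<Sum>j=1..N. \<Sum>k=1..N. if j = k then (a j)\<^sup>2 else 0)"
    by (intro sum.cong refl) (simp add: ortho power2_eq_square)
  also have "\<dots> = (\<Sum>k=1..N. (a k)\<^sup>2)" by simp
  finally show ?thesis .
qed

text \<open>Cauchy-Schwarz against the constant \<open>1\<close>, obtained by integrating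
  \<open>\<bar>y\<bar> \<le> y\<^sup>2 / (2 * c) + c / 2\<close> over an interval of length
  one.\<close>

lemma integral_abs_le_L2:
  assumes f: "f \<in> L2_01" and bound: "(\<integral>x. (f x)\<^sup>2 \<partial>unit_measure) \<le> c\<^sup>2" and c: "c > 0"
  shows "(\<integral>x. \<bar>f x\<bar> \<partial>unit_measure) \<le> c"
proof -
  have amgm: "\<bar>y\<bar> \<le> y\<^sup>2 / (2 * c) + c / 2" for y
    using sum_squares_bound[of "\<bar>y\<bar>" c] c by (simp add: field_simps power2_eq_square)
  have int: "integrable unit_measure (\<lambda>x. (f x)\<^sup>2 / (2 * c))"
    using f by (simp add: L2_01_iff)
  have "(\<integral>x. \<bar>f x\<bar> \<partial>unit_measure) \<le> (\<integral>x. (f x)\<^sup>2 / (2 * c) + c / 2 \<partial>unit_measure)"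
    using amgm int integrable_L2_01[OF f] by (intro integral_mono) auto
  also have "\<dots> = (\<integral>x. (f x)\<^sup>2 \<partial>unit_measure) / (2 * c) + c / 2"
    using int by (simp add: measure_restrict_space)
  also have "\<dots> \<le> c\<^sup>2 / (2 * c) + c / 2"
    using bound c by (intro add_right_mono divide_right_mono) auto
  also have "\<dots> = c" using c by (simp add: power2_eq_square)
  finally show ?thesis .
qed

subsection \<open>Ramp approximation of step functions\<close>

text \<open>For \<open>N \<ge> 1\<close> this is \<open>1/N\<close> to the left of
  \<open>i/N\<close>, falls with slope \<open>-1\<close>, and vanishes from \<open>(i+1)/N\<close>
  on. Written as a difference of consecutive terms, it telescopes when summed over
  \<open>i\<close>.\<close>

definition ramp :: "nat \<Rightarrow> nat \<Rightarrow> real \<Rightarrow> real" where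
  "ramp N i x = max 0 (real (Suc i) / real N - x) - max 0 (real i / real N - x)"

lemma sum_Suc_diff_from_1:
  fixes g :: "nat \<Rightarrow> real"
  assumes "N \<ge> 1"
  shows "(\<Sum>i=1..N-1. g (Suc i) - g i) = g N - g 1"
  using sum_Suc_diff[of 1 "N - 1" g] assms by simp

text \<open>Sandwiching the ramp between consecutive scaled steps bounds the error of replacing a
  step by a ramp by a telescoping difference.\<close>

lemma ramp_bounds:
  assumes "N \<ge> 1"
  shows "indicator {..real i / real N} x / real N \<le> ramp N i x"
    and "ramp N i x \<le> indicator {..real (Suc i) / real N} x / real N"
proof -
  have Suc: "real (Suc i) / real N = real i / real N + 1 / real N"
    by (simp add: add_divide_distrib)
  have "0 < 1 / real N" using assms by simp
  then show "indicator {..real i / real N} x / real N \<le> ramp N i x"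
    and "ramp N i x \<le> indicator {..real (Suc i) / real N} x / real N"
    unfolding ramp_def Suc by (auto simp: indicator_def max_def)
qed

lemma ramp_antimono:
  assumes "N \<ge> 1" "x \<le> y"
  shows "ramp N i y \<le> ramp N i x"
proof -
  have "real i / real N \<le> real (Suc i) / real N" by (simp add: divide_right_mono)
  then show ?thesis using assms(2) by (auto simp: ramp_def max_def)
qed

lemma sum_ramp_lip_ball:
  assumes N: "N \<ge> 1" and s: "\<And>i. \<bar>s i\<bar> \<le> 1"
  shows "(\<lambda>x. \<Sum>i=1..N-1. s i * ramp N i x) \<in> lip_ball 1"
proof (rule lip_ballI)
  fix x y :: real assume xy: "x \<le> y"
  have "\<bar>(\<Sum>i=1..N-1. s i * ramp N i x) - (\<Sum>i=1..N-1. s i * ramp N i y)\<bar>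
      = \<bar>\<Sum>i=1..N-1. s i * (ramp N i x - ramp N i y)\<bar>"
    by (simp add: sum_subtractf right_diff_distrib)
  also have "\<dots> \<le> (\<Sum>i=1..N-1. \<bar>s i * (ramp N i x - ramp N i y)\<bar>)" by (rule sum_abs)
  also have "\<dots> \<le> (\<Sum>i=1..N-1. ramp N i x - ramp N i y)"
  proof (rule sum_mono)
    fix i show "\<bar>s i * (ramp N i x - ramp N i y)\<bar> \<le> ramp N i x - ramp N i y"
      using mult_right_mono[OF s[of i], of "ramp N i x - ramp N i y"] ramp_antimono[OF N xy, of i]
      by (simp add: abs_mult)
  qed
  also have "\<dots> = (\<Sum>i=1..N-1. ramp N i x) - (\<Sum>i=1..N-1. ramp N i y)"
    by (rule sum_subtractf)
  \<comment> \<open>Telescoping leaves one long ramp from \<open>1/N\<close> to \<open>1\<close>,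
    again of slope \<open>-1\<close>.\<close>
  also have "\<dots> = (max 0 (1 - x) - max 0 (1 / real N - x)) - (max 0 (1 - y) - max 0 (1 / real N - y))"
    unfolding ramp_def using N
    by (simp only: sum_Suc_diff_from_1[OF N, where g = "\<lambda>i. max 0 (real i / real N - _)"]) simp
  also have "\<dots> \<le> 1 * (y - x)" using xy by (auto simp: max_def)
  finally show "\<bar>(\<Sum>i=1..N-1. s i * ramp N i x) - (\<Sum>i=1..N-1. s i * ramp N i y)\<bar> \<le> 1 * (y - x)" .
next
  fix x
  have r: "\<bar>ramp N i x\<bar> \<le> 1 / real N" for i
  proof -
    have "0 \<le> indicator {..real i / real N} x / real N" by simp
    moreover have "indicator {..real (Suc i) / real N} x / real N \<le> 1 / real N"
      by (intro divide_right_mono) (auto simp: indicator_def)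
    ultimately show ?thesis using ramp_bounds[OF N, of i x] by linarith
  qed
  have "\<bar>\<Sum>i=1..N-1. s i * ramp N i x\<bar> \<le> (\<Sum>i=1..N-1. \<bar>s i * ramp N i x\<bar>)" by (rule sum_abs)
  also have "\<dots> \<le> (\<Sum>i=1..N-1. 1 * (1 / real N))"
    unfolding abs_mult by (intro sum_mono mult_mono s r) auto
  also have "\<dots> \<le> 1" using N by simp
  finally show "\<bar>\<Sum>i=1..N-1. s i * ramp N i x\<bar> \<le> 1" .
qed simp

text \<open>At each point at most one step differs from its ramp, so the errors do not add up;
  \<open>ramp_bounds\<close> expresses this as a telescoping sum.\<close>

lemma sum_ramp_approx:
  assumes N: "N \<ge> 1" and s: "\<And>i. \<bar>s i\<bar> \<le> 1"
  shows "\<bar>(\<Sum>i=1..N-1. s i * (indicator {..real i / real N} x / real N))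
           - (\<Sum>i=1..N-1. s i * ramp N i x)\<bar> \<le> 1 / real N"
proof -
  let ?I = "\<lambda>i. indicator {..real i / real N} x / real N :: real"
  have "\<bar>(\<Sum>i=1..N-1. s i * ?I i) - (\<Sum>i=1..N-1. s i * ramp N i x)\<bar>
      = \<bar>\<Sum>i=1..N-1. s i * (?I i - ramp N i x)\<bar>"
    by (simp add: sum_subtractf right_diff_distrib)
  also have "\<dots> \<le> (\<Sum>i=1..N-1. \<bar>s i * (?I i - ramp N i x)\<bar>)" by (rule sum_abs)
  also have "\<dots> \<le> (\<Sum>i=1..N-1. ?I (Suc i) - ?I i)"
  proof (rule sum_mono)
    fix i
    have "\<bar>s i * (?I i - ramp N i x)\<bar> \<le> \<bar>?I i - ramp N i x\<bar>"
      using mult_right_mono[OF s[of i], of "\<bar>?I i - ramp N i x\<bar>"] by (simp add: abs_mult)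
    then show "\<bar>s i * (?I i - ramp N i x)\<bar> \<le> ?I (Suc i) - ?I i"
      using ramp_bounds[OF N, of i x] by linarith
  qed
  also have "\<dots> = ?I N - ?I 1" by (rule sum_Suc_diff_from_1[OF N])
  also have "\<dots> \<le> 1 / real N"
  proof -
    have "?I N \<le> 1 / real N" by (intro divide_right_mono) (auto simp: indicator_def)
    moreover have "0 \<le> ?I 1" by simp
    ultimately show ?thesis by linarith
  qed
  finally show ?thesis .
qed

subsection \<open>The partial sums of the weighted coefficients\<close>

lemma fourier_coeff_unit: "fourier_coeff \<phi> f n = (\<integral>x. f x * \<phi> n x \<partial>unit_measure)"
  by (simp add: fourier_coeff_def set_integral_unit)

text \<open>Duality: \<open>D\<close> is the integral of \<open>Q\<close> against a step function
  with sign coefficients. Its ramp version \<open>f\<close> depends on \<open>N\<close>, but both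
  the ball containing it and the error \<open>C\<close> do not.\<close>

lemma D_le_sum_coeff:
  assumes ons: "orthonormal_system \<phi>" and \<epsilon>: "\<epsilon> \<in> Delta" and N: "N \<ge> 1"
    and d0: "\<And>k. k \<ge> 1 \<Longrightarrow> d k > 0" and dC: "\<And>k. k \<ge> 1 \<Longrightarrow> d k \<le> C"
  shows "\<exists>f\<in>lip_ball 1. D \<phi> d N \<epsilon> \<le> (\<Sum>k=1..N. \<bar>fourier_coeff \<phi> f k\<bar> * sqrt (real k) * d k) + C"
proof -
  define a where "a k = d k * sqrt (real k) * \<epsilon> k" for k
  define q where "q x = (\<Sum>k=1..N. a k * \<phi> k x)" for x
  have Q_q: "Q \<phi> d N x \<epsilon> = q x" for x
    by (simp add: Q_def q_def a_def mult_ac)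
  have L2: "\<phi> k \<in> L2_01" if "k \<ge> 1" for k
    using ons that by (simp add: orthonormal_system_def)
  have q_L2: "q \<in> L2_01" unfolding q_def[abs_def] by (rule L2_01_sum) (auto intro: L2)
  have C: "C > 0" using d0[of 1] dC[of 1] by simp
  have \<epsilon>1: "\<bar>\<epsilon> k\<bar> \<le> 1" if "k \<ge> 1" for k
    using \<epsilon> that by (auto simp: Delta_def)
  have "(\<integral>x. (q x)\<^sup>2 \<partial>unit_measure) = (\<Sum>k=1..N. (a k)\<^sup>2)"
    unfolding q_def by (rule orthonormal_integral_square_sum[OF ons])
  \<comment> \<open>Bounding the weight \<open>k\<close> by \<open>N\<close> in each of the
    \<open>N\<close> terms gives an L1 norm of order \<open>N\<close>, which the factor
    \<open>1/N\<close> of the ramp approximation cancels.\<close>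
  also have "\<dots> \<le> (\<Sum>k=1..N. C\<^sup>2 * real N)"
  proof (rule sum_mono)
    fix k assume k: "k \<in> {1..N}"
    then have "(d k)\<^sup>2 \<le> C\<^sup>2" "(\<epsilon> k)\<^sup>2 \<le> 1"
      using d0[of k] dC[of k] \<epsilon>1[of k] by (auto intro: power_mono simp: abs_square_le_1)
    moreover have "(a k)\<^sup>2 = (d k)\<^sup>2 * real k * (\<epsilon> k)\<^sup>2"
      by (simp add: a_def power_mult_distrib)
    moreover have "(d k)\<^sup>2 * real k * (\<epsilon> k)\<^sup>2 \<le> C\<^sup>2 * real N * 1"
      by (intro mult_mono) (use calculation k in auto)
    ultimately show "(a k)\<^sup>2 \<le> C\<^sup>2 * real N" by simp
  qed
  also have "\<dots> = (C * real N)\<^sup>2" by (simp add: power2_eq_square)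
  finally have q_abs: "(\<integral>x. \<bar>q x\<bar> \<partial>unit_measure) \<le> C * real N"
    by (intro integral_abs_le_L2[OF q_L2]) (use C N in auto)
  \<comment> \<open>These signs remove the absolute values in \<open>D\<close>. The half-lines
    \<open>{..i/N}\<close> can replace \<open>{0..i/N}\<close> because integration is over
    \<open>{0..1}\<close>.\<close>
  define s where "s i = sgn (\<integral>x. indicator {..real i / real N} x * q x \<partial>unit_measure)" for i
  have s1: "\<bar>s i\<bar> \<le> 1" for i by (simp add: s_def sgn_real_def)
  define h where "h x = (\<Sum>i=1..N-1. s i * (indicator {..real i / real N} x / real N))" for x :: real
  define f where "f x = (\<Sum>i=1..N-1. s i * ramp N i x)" for x
  have f: "f \<in> lip_ball 1" unfolding f_def[abs_def] by (rule sum_ramp_lip_ball[OF N s1])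
  have hf: "\<bar>h x - f x\<bar> \<le> 1 / real N" for x
    unfolding h_def f_def by (rule sum_ramp_approx[OF N s1])
  have ind_int: "integrable unit_measure (\<lambda>x. indicator {..t} x * q x)" for t :: real
  proof (rule Bochner_Integration.integrable_bound)
    show "integrable unit_measure q" by (rule integrable_L2_01[OF q_L2])
    have "(indicator {..t} :: real \<Rightarrow> real) \<in> borel_measurable unit_measure"
      by (intro measurable_restrict_space1 borel_measurable_indicator) simp
    then show "(\<lambda>x. indicator {..t} x * q x) \<in> borel_measurable unit_measure"
      using q_L2 by (auto simp: L2_01_iff)
  qed (auto simp: indicator_def)
  have Q_ind: "(LINT x:{0..real i / real N}|lebesgue. Q \<phi> d N x \<epsilon>) =
      (\<integral>x. indicator {..real i / real N} x * q x \<partial>unit_measure)" if "i \<in> {1..N-1}" for i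
  proof -
    have "real i / real N \<le> 1" using that N by (simp add: field_simps) linarith
    then have "indicator {0..real i / real N} x = indicator {0..1} x * (indicator {..real i / real N} x :: real)"
      for x :: real by (auto simp: indicator_def)
    then show ?thesis
      by (simp add: Q_q set_lebesgue_integral_def integral_restrict_space mult.assoc)
  qed
  have h_q: "h x * q x = (\<Sum>i=1..N-1. s i / real N * (indicator {..real i / real N} x * q x))" for x
    unfolding h_def sum_distrib_right by (intro sum.cong refl) simp
  have hq_int: "integrable unit_measure (\<lambda>x. h x * q x)"
    unfolding h_q using ind_int
    by (intro Bochner_Integration.integrable_sum Bochner_Integration.integrable_mult_right) auto
  have "D \<phi> d N \<epsilon> = (\<Sum>i=1..N-1. s i / real N * (\<integral>x. indicator {..real i / real N} x * q x \<partial>unit_measure))"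
    unfolding D_def sum_distrib_left
    by (intro sum.cong refl) (simp add: Q_ind s_def abs_sgn mult_ac)
  also have "\<dots> = (\<integral>x. h x * q x \<partial>unit_measure)"
    unfolding h_q using ind_int by (subst Bochner_Integration.integral_sum) auto
  \<comment> \<open>Passing from \<open>h\<close> to \<open>f\<close> costs at most
    \<open>1/N\<close> times the L1 norm of \<open>q\<close>.\<close>
  also have "\<dots> \<le> (\<integral>x. f x * q x + 1 / real N * \<bar>q x\<bar> \<partial>unit_measure)"
  proof (rule integral_mono[OF hq_int])
    show "integrable unit_measure (\<lambda>x. f x * q x + 1 / real N * \<bar>q x\<bar>)"
      using integrable_lip_ball_mult[OF f q_L2] integrable_L2_01[OF q_L2] by simp
    fix x
    have "(h x - f x) * q x \<le> \<bar>h x - f x\<bar> * \<bar>q x\<bar>"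
      by (metis abs_ge_self abs_mult)
    also have "\<dots> \<le> 1 / real N * \<bar>q x\<bar>" by (rule mult_right_mono[OF hf]) simp
    finally show "h x * q x \<le> f x * q x + 1 / real N * \<bar>q x\<bar>" by (simp add: left_diff_distrib)
  qed
  also have "\<dots> = (\<integral>x. f x * q x \<partial>unit_measure) + 1 / real N * (\<integral>x. \<bar>q x\<bar> \<partial>unit_measure)"
    using integrable_lip_ball_mult[OF f q_L2] integrable_L2_01[OF q_L2] by simp
  also have "1 / real N * (\<integral>x. \<bar>q x\<bar> \<partial>unit_measure) \<le> C"
    using q_abs N by (simp add: field_simps)
  also have "(\<integral>x. f x * q x \<partial>unit_measure) = (\<Sum>k=1..N. a k * fourier_coeff \<phi> f k)"
  proof -
    have "f x * q x = (\<Sum>k=1..N. a k * (f x * \<phi> k x))" for x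
      by (simp add: q_def sum_distrib_left mult_ac)
    then show ?thesis
      using integrable_lip_ball_mult[OF f L2]
      by (simp add: fourier_coeff_unit)
  qed
  also have "\<dots> \<le> (\<Sum>k=1..N. \<bar>fourier_coeff \<phi> f k\<bar> * sqrt (real k) * d k)"
  proof (rule sum_mono)
    fix k assume k: "k \<in> {1..N}"
    have "a k * fourier_coeff \<phi> f k \<le> \<bar>\<epsilon> k\<bar> * (\<bar>fourier_coeff \<phi> f k\<bar> * sqrt (real k) * d k)"
      using k d0[of k] abs_ge_self[of "a k * fourier_coeff \<phi> f k"]
      by (simp add: a_def abs_mult mult_ac)
    also have "\<dots> \<le> 1 * (\<bar>fourier_coeff \<phi> f k\<bar> * sqrt (real k) * d k)"
      using k d0[of k] \<epsilon>1[of k] by (intro mult_right_mono) auto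
    finally show "a k * fourier_coeff \<phi> f k \<le> \<bar>fourier_coeff \<phi> f k\<bar> * sqrt (real k) * d k" by simp
  qed
  finally show ?thesis using f by (intro bexI[of _ f]) auto
qed

text \<open>All terms are nonnegative, so a finite value of the series would bound every partial
  sum.\<close>

lemma unbounded_partial_sums_imp_weighted_coeff_series_top:
  assumes d0: "\<And>k. k \<ge> 1 \<Longrightarrow> d k > 0"
    and unbdd: "\<And>A. \<exists>N. (\<Sum>k=1..N. \<bar>fourier_coeff \<phi> f k\<bar> * sqrt (real k) * d k) > A"
  shows "weighted_coeff_series \<phi> d f = \<infinity>"
proof (rule ccontr)
  let ?u = "\<lambda>k. \<bar>fourier_coeff \<phi> f k\<bar> * sqrt (real k) * d k"
  assume "weighted_coeff_series \<phi> d f \<noteq> \<infinity>"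
  then obtain B where B: "B \<ge> 0" "weighted_coeff_series \<phi> d f = ennreal B"
    by (cases "weighted_coeff_series \<phi> d f") auto
  obtain N where N: "(\<Sum>k=1..N. ?u k) > B" using unbdd by blast
  have u0: "0 \<le> ?u (Suc k)" for k using d0[of "Suc k"] by simp
  \<comment> \<open>The series runs from \<open>0\<close> through \<open>Suc\<close>, the partial
    sums from \<open>1\<close>.\<close>
  have "ennreal (\<Sum>k=1..N. ?u k) = ennreal (\<Sum>k<N. ?u (Suc k))"
    by (simp add: sum.atLeast1_atMost_eq)
  also have "\<dots> = (\<Sum>k<N. ennreal (?u (Suc k)))"
    using u0 by (intro sum_ennreal[symmetric])
  also have "\<dots> \<le> weighted_coeff_series \<phi> d f"
    unfolding weighted_coeff_series_def by (intro sum_le_suminf) auto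
  finally show False using N B by (simp add: ennreal_le_iff)
qed

section \<open>Uniform boundedness applied to the partial sums of the weighted coefficients\<close>

theorem theorem6:
  fixes \<phi> :: "nat \<Rightarrow> real \<Rightarrow> real" and d :: "nat \<Rightarrow> real" and \<epsilon>0 :: "nat \<Rightarrow> real"
  assumes "orthonormal_system \<phi>"
    and "bounded_positive_seq d"
    and "\<epsilon>0 \<in> Delta"
    and "limsup (\<lambda>N. ereal (D \<phi> d N \<epsilon>0)) = \<infinity>"
  shows "\<not> absolute_convergence_factor \<phi> d Lip1 \<and>
         (\<exists>f0\<in>Lip1. weighted_coeff_series \<phi> d f0 = \<infinity>)"
proof -
  have d0: "\<And>k. k \<ge> 1 \<Longrightarrow> d k > 0" using assms(2) by (simp add: bounded_positive_seq_def)
  obtain C where dC: "\<And>k. k \<ge> 1 \<Longrightarrow> d k \<le> C"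
    using assms(2) unfolding bounded_positive_seq_def bounded_iff
    by (metis abs_ge_self atLeast_iff image_eqI order_trans real_norm_def)
  have L2: "\<phi> k \<in> L2_01" if "k \<ge> 1" for k
    using assms(1) that by (simp add: orthonormal_system_def)
  \<comment> \<open>Seminorms whose supremum over \<open>N\<close> is the weighted series.\<close>
  define p where "p N f = (\<Sum>k=1..N. \<bar>fourier_coeff \<phi> f k\<bar> * sqrt (real k) * d k)" for N f
  have "\<exists>r. \<exists>f\<in>lip_ball r. \<forall>A. \<exists>n. p n f > A"
  proof (rule uniform_boundedness_lip_ball)
    fix n f g r s assume f: "f \<in> lip_ball r" and g: "g \<in> lip_ball s"
    have "fourier_coeff \<phi> (\<lambda>x. f x + g x) k = fourier_coeff \<phi> f k + fourier_coeff \<phi> g k"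
      if "k \<ge> 1" for k
      using integrable_lip_ball_mult[OF f L2[OF that]] integrable_lip_ball_mult[OF g L2[OF that]]
      by (simp add: fourier_coeff_unit distrib_right)
    then show "p n (\<lambda>x. f x + g x) \<le> p n f + p n g"
      unfolding p_def sum.distrib[symmetric] distrib_right[symmetric]
      using d0 by (intro sum_mono mult_right_mono) (auto intro: less_imp_le)
  next
    fix n f r and c :: real
    show "p n (\<lambda>x. c * f x) = \<bar>c\<bar> * p n f"
      by (simp add: p_def fourier_coeff_unit sum_distrib_left abs_mult mult.assoc)
  next
    fix n
    \<comment> \<open>For a fixed number of terms, \<open>\<bar>f x\<bar> \<le> 1\<close> bounds
      each coefficient by the L1 norm of \<open>\<phi> k\<close>.\<close>
    have "p n f \<le> (\<Sum>k=1..n. (\<integral>x. \<bar>\<phi> k x\<bar> \<partial>unit_measure) * sqrt (real k) * d k)"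
      if f: "f \<in> lip_ball 1" for f
      unfolding p_def
    proof (intro sum_mono mult_right_mono)
      fix k assume "k \<in> {1..n}"
      then have k: "k \<ge> 1" by simp
      then show "0 \<le> d k" using d0 by (simp add: less_imp_le)
      have "\<bar>fourier_coeff \<phi> f k\<bar> \<le> (\<integral>x. \<bar>f x * \<phi> k x\<bar> \<partial>unit_measure)"
        unfolding fourier_coeff_unit by (rule integral_abs_bound)
      also have "\<dots> \<le> (\<integral>x. \<bar>\<phi> k x\<bar> \<partial>unit_measure)"
      proof (rule integral_mono)
        show "\<bar>f x * \<phi> k x\<bar> \<le> \<bar>\<phi> k x\<bar>" for x
          using mult_right_mono[OF lip_ballD(2)[OF f], of "\<bar>\<phi> k x\<bar>" x] by (simp add: abs_mult)
      qed (use integrable_lip_ball_mult[OF f L2[OF k]] integrable_L2_01[OF L2[OF k]] in auto)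
      finally show "\<bar>fourier_coeff \<phi> f k\<bar> \<le> (\<integral>x. \<bar>\<phi> k x\<bar> \<partial>unit_measure)" .
    qed simp
    then show "\<exists>K. \<forall>f\<in>lip_ball 1. p n f \<le> K" by blast
  next
    fix A
    \<comment> \<open>The shift by \<open>C\<close> pays for the error in
      \<open>D_le_sum_coeff\<close>; \<open>N \<ge> 1\<close> excludes the degenerate division by
      zero.\<close>
    have "\<exists>N\<ge>1. D \<phi> d N \<epsilon>0 > A + C"
    proof (rule ccontr)
      assume "\<not> ?thesis"
      then have "\<forall>\<^sub>F N in sequentially. ereal (D \<phi> d N \<epsilon>0) \<le> ereal (A + C)"
        by (intro eventually_sequentiallyI[of 1]) (auto simp: not_less)
      then have "limsup (\<lambda>N. ereal (D \<phi> d N \<epsilon>0)) \<le> ereal (A + C)"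
        by (rule Limsup_bounded)
      then show False using assms(4) by simp
    qed
    then obtain N where N: "N \<ge> 1" "D \<phi> d N \<epsilon>0 > A + C" by blast
    obtain f where "f \<in> lip_ball 1" "D \<phi> d N \<epsilon>0 \<le> p N f + C"
      using D_le_sum_coeff[of \<phi> \<epsilon>0 N d C] assms(1,3) N(1) d0 dC unfolding p_def by blast
    then show "\<exists>n. \<exists>f\<in>lip_ball 1. p n f > A"
      using N(2) by (intro exI[of _ N] bexI[of _ f]) auto
  qed
  then obtain r f where f: "f \<in> lip_ball r" and unbdd: "\<And>A. \<exists>n. p n f > A" by blast
  have "f \<in> Lip1"
    using f by (auto simp: lip_ball_def Lip1_def intro: lipschitz_on_subset)
  moreover have "weighted_coeff_series \<phi> d f = \<infinity>"
    by (rule unbounded_partial_sums_imp_weighted_coeff_series_top)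
      (use d0 unbdd in \<open>simp_all add: p_def\<close>)
  ultimately show ?thesis
    unfolding absolute_convergence_factor_def by (metis less_irrefl)
qed

end
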